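(* Let $q>1$ be an odd square-full number and let $m\geq 2$ be an integer. Then for any integer $n$ with $(n,q)=1$, $$\sum_{\chi \bmod q}|G(n,\chi;q)|^{2m}=4^{(m-1)\omega(q)}\cdot q^{m-1}\cdot \phi^2(q),$$ where the sum runs over all Dirichlet characters $\chi$ modulo $q$.
   Context: For an integer $q\geq 2$, a Dirichlet character $\chi$ modulo $q$ and an integer $n$, the generalized quadratic Gauss sum is $G(n,\chi;q)=\sum_{a=1}^{q}\chi(a)\,e\left(\frac{na^2}{q}\right)$, where $e(x)=e^{2\pi i x}$. A positive integer $q$ is square-full if $p^2\mid q$ for every prime $p\mid q$. $(n,q)$ denotes the greatest common divisor, $\omega(q)$ is the number of distinct prime divisors of $q$, $\phi$ is the Euler function, and $\phi^2(q)=(\phi(q))^2$. *)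

theory Defs
  imports Complex_Main "HOL-Number_Theory.Number_Theory"
begin

text \<open>
  Characters are total functions on the integers that vanish off the residues coprime to
  \<open>q\<close>, so distinct characters modulo \<open>q\<close> are distinct functions and the set of all of them
  is finite for \<open>q > 0\<close>. The equation \<open>\<chi> 1 = 1\<close> follows from the multiplicativity and
  \<open>\<chi> 1 \<noteq> 0\<close>.
\<close>

definition dirichlet_character :: "nat \<Rightarrow> (int \<Rightarrow> complex) \<Rightarrow> bool" where
  "dirichlet_character q \<chi> \<longleftrightarrow>
     (\<forall>a b. \<chi> (a * b) = \<chi> a * \<chi> b) \<and>
     (\<forall>a. \<chi> (a + int q) = \<chi> a) \<and>
     (\<forall>a. \<chi> a \<noteq> 0 \<longleftrightarrow> coprime a (int q))"

definition add_char :: "real \<Rightarrow> complex" where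
  "add_char x = exp (2 * complex_of_real pi * \<i> * complex_of_real x)"

definition quad_gauss_sum :: "int \<Rightarrow> (int \<Rightarrow> complex) \<Rightarrow> nat \<Rightarrow> complex" where
  "quad_gauss_sum n \<chi> q =
     (\<Sum>a = 1..int q. \<chi> a * add_char (real_of_int (n * a\<^sup>2) / real q))"

definition square_full :: "nat \<Rightarrow> bool" where
  "square_full q \<longleftrightarrow> q > 0 \<and> (\<forall>p. prime p \<longrightarrow> p dvd q \<longrightarrow> p\<^sup>2 dvd q)"

definition num_prime_divisors :: "nat \<Rightarrow> nat" where
  "num_prime_divisors q = card {p. prime p \<and> p dvd q}"

end

theory Submission
  imports Defs "HOL-Computational_Algebra.Squarefree"
begin

text \<open>
  Write \<open>G \<chi>\<close> for the quadratic Gauss sum. The proof rests on a dichotomy: for every character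
  \<open>\<chi>\<close>, \<open>|G \<chi>|\<^sup>2\<close> is either \<open>0\<close> or \<open>c = 4 ^ \<omega>(q) * q\<close>. Hence
  \<open>|G \<chi>| ^ (2 * m) = c ^ (m - 1) * |G \<chi>|\<^sup>2\<close> for every \<open>\<chi>\<close>, and all moments reduce to the second one,
  which orthogonality of characters evaluates to \<open>\<phi>(q)\<^sup>2\<close> (\<open>second_moment_quad_gauss_sum\<close>).

  The dichotomy (\<open>norm_square_dichotomy\<close>) is a stationary phase argument. Since \<open>q\<close> is
  square-full, \<open>q = r\<^sup>2 * d\<close> with \<open>d dvd r\<close>. The unit \<open>w = 1 + r * d\<close> satisfies
  \<open>w\<^sup>2 \<equiv> 1 + 2 * r * d\<close> modulo \<open>q\<close>, so replacing \<open>a\<close> by \<open>w * a\<close> multiplies the summand \<open>F a\<close> of the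
  Gauss sum by a root of unity \<open>z a\<close>. Averaging over the powers of \<open>w\<close> leaves only the stationary
  points, those \<open>a\<close> with \<open>z a = 1\<close> (\<open>sum_gauss_term_stationary\<close>). As \<open>z a\<close> determines \<open>a\<^sup>2\<close>
  modulo \<open>r\<close>, they form, if there is one at all, say \<open>y\<close>, the residue classes of \<open>e * y\<close> modulo
  \<open>r\<close>, where \<open>e\<close> runs through the square roots of one modulo \<open>q\<close>
  (\<open>stationary_points_partition\<close>).

  The square roots of one form a group of order \<open>2 ^ \<omega>(q)\<close> because \<open>q\<close> is odd
  (\<open>card_sqrts_one_mod\<close>), and \<open>F (e * a) = \<chi> e * F a\<close>. If \<open>\<chi>\<close> is nontrivial on this group, then
  \<open>G \<chi> = 0\<close>. Otherwise all these residue classes contribute the same amount \<open>T\<close>, so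
  \<open>G \<chi> = 2 ^ \<omega>(q) * T\<close>, and \<open>|T|\<^sup>2 = q\<close> by a direct evaluation
  (\<open>norm_square_stationary_class\<close>).

  Orthogonality over the characters requires that they separate the units modulo \<open>q\<close>; for odd
  \<open>q\<close> such characters come from discrete logarithms to primitive roots modulo prime powers.
\<close>

section \<open>Sums over the units of a residue ring\<close>

definition units_mod :: "nat \<Rightarrow> int set" where
  "units_mod q = {a \<in> {0..<int q}. coprime a (int q)}"

lemma units_modD: "a \<in> units_mod q \<Longrightarrow> coprime a (int q)"
  by (simp add: units_mod_def)

lemma finite_units_mod [simp]: "finite (units_mod q)"
  by (rule finite_subset[of _ "{0..<int q}"]) (auto simp: units_mod_def)

lemma mod_in_units_mod: "q > 0 \<Longrightarrow> coprime a (int q) \<Longrightarrow> a mod int q \<in> units_mod q"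
  by (simp add: units_mod_def)

lemma units_mod_cong_imp_eq:
  "a \<in> units_mod q \<Longrightarrow> b \<in> units_mod q \<Longrightarrow> [a = b] (mod int q) \<Longrightarrow> a = b"
  by (auto simp: units_mod_def intro: cong_less_imp_eq_int)

lemma card_units_mod:
  assumes "q > 1"
  shows "card (units_mod q) = totient q"
proof -
  have "bij_betw int (totatives q) (units_mod q)"
  proof (rule bij_betw_byWitness[where f' = nat])
    show "int ` totatives q \<subseteq> units_mod q"
      using totatives_less[OF _ assms] by (auto simp: in_totatives_iff units_mod_def)
    show "nat ` units_mod q \<subseteq> totatives q"
    proof
      fix x assume "x \<in> nat ` units_mod q"
      then obtain a where a: "x = nat a" "a \<in> units_mod q" by blast
      from a have "int x = a" by (simp add: units_mod_def)
      with a(2) have "coprime (int x) (int q)" "x < q" by (auto simp: units_mod_def)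
      moreover from this assms have "x > 0" by (cases "x = 0") auto
      ultimately show "x \<in> totatives q" by (simp add: in_totatives_iff)
    qed
  qed (auto simp: units_mod_def)
  thus ?thesis using bij_betw_same_card totient_def by metis
qed

lemma sum_units_mod_mult:
  fixes g :: "int \<Rightarrow> complex"
  assumes "q > 0" "coprime u (int q)"
    and per: "\<And>a b. [a = b] (mod int q) \<Longrightarrow> g a = g b"
  shows "(\<Sum>a\<in>units_mod q. g (u * a)) = (\<Sum>a\<in>units_mod q. g a)"
proof -
  let ?f = "\<lambda>a. (u * a) mod int q"
  have inj: "inj_on ?f (units_mod q)"
  proof (rule inj_onI)
    fix a b assume ab: "a \<in> units_mod q" "b \<in> units_mod q" and "?f a = ?f b"
    hence "[u * a = u * b] (mod int q)" by (simp add: cong_def)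
    hence "[a = b] (mod int q)" using assms(2) by (simp add: cong_mult_lcancel)
    thus "a = b" using ab units_mod_cong_imp_eq by blast
  qed
  have sub: "?f ` units_mod q \<subseteq> units_mod q"
    using assms by (auto simp: units_mod_def)
  have "bij_betw ?f (units_mod q) (units_mod q)"
    using inj sub by (simp add: bij_betw_def card_subset_eq card_image)
  hence "(\<Sum>a\<in>units_mod q. g (?f a)) = (\<Sum>a\<in>units_mod q. g a)"
    by (rule sum.reindex_bij_betw)
  moreover have "g (?f a) = g (u * a)" for a by (rule per) simp
  ultimately show ?thesis by simp
qed

text \<open>
  The hypothesis \<open>lift\<close> says that \<open>r\<close> and \<open>q\<close> have the same prime divisors. Then the whole residue
  class of \<open>y\<close> modulo \<open>r\<close> consists of units, and it is an arithmetic progression.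
\<close>

lemma sum_units_mod_residue_class:
  fixes g :: "int \<Rightarrow> complex"
  assumes "q = r * s" "q > 0" and y: "coprime y (int q)"
    and lift: "\<And>a. coprime a (int r) \<Longrightarrow> coprime a (int q)"
    and per: "\<And>a b. [a = b] (mod int q) \<Longrightarrow> g a = g b"
  shows "(\<Sum>a | a \<in> units_mod q \<and> [a = y] (mod int r). g a) = (\<Sum>t<s. g (y + int r * int t))"
proof -
  let ?f = "\<lambda>t. (y + int r * int t) mod int q"
  have pos: "r > 0" "s > 0" using assms(1,2) by auto
  have cop: "coprime (y + int r * int t) (int q)" for t
  proof (rule lift)
    have "coprime y (int r)" using y assms(1) by simp
    moreover have "[y = y + int r * int t] (mod int r)" by (simp add: cong_def)
    ultimately show "coprime (y + int r * int t) (int r)" by (rule coprime_cong_transfer_left)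
  qed
  have "bij_betw ?f {..<s} {a. a \<in> units_mod q \<and> [a = y] (mod int r)}"
    unfolding bij_betw_def
  proof
    show "inj_on ?f {..<s}"
    proof (rule inj_onI)
      fix t t' assume tt: "t \<in> {..<s}" "t' \<in> {..<s}" "?f t = ?f t'"
      hence "[y + int r * int t = y + int r * int t'] (mod int q)" by (simp add: cong_def)
      hence "int q dvd (y + int r * int t) - (y + int r * int t')" by (simp add: cong_iff_dvd_diff)
      hence "int r * int s dvd int r * (int t - int t')"
        by (simp add: assms(1) algebra_simps)
      hence "int s dvd int t - int t'" using pos by simp
      hence "[int t = int t'] (mod int s)" by (simp add: cong_iff_dvd_diff)
      thus "t = t'" using tt by (simp add: cong_def)
    qed
    show "?f ` {..<s} = {a. a \<in> units_mod q \<and> [a = y] (mod int r)}"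
    proof safe
      fix t
      show "?f t \<in> units_mod q" using cop assms(2) by (rule mod_in_units_mod[rotated])
      have "[?f t = y + int r * int t] (mod int r)"
        by (rule cong_dvd_modulus[of _ _ "int q"]) (auto simp: assms(1))
      thus "[?f t = y] (mod int r)" by (simp add: cong_def)
    next
      fix a assume a: "a \<in> units_mod q" "[a = y] (mod int r)"
      then obtain k where k: "a = y + int r * k" by (metis cong_iff_lin cong_sym)
      define t where "t = nat (k mod int s)"
      have t: "int t = k mod int s" "t < s" using pos by (auto simp: t_def nat_less_iff)
      have "int s dvd k - k mod int s" by simp
      hence "int r * int s dvd int r * (k - int t)" unfolding t(1) by (rule mult_dvd_mono[OF dvd_refl])
      hence "[a = y + int r * int t] (mod int q)"
        by (simp add: cong_iff_dvd_diff k assms(1) algebra_simps)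
      hence "a = ?f t" using a(1) by (simp add: cong_def units_mod_def)
      thus "a \<in> ?f ` {..<s}" using t(2) by blast
    qed
  qed
  hence "(\<Sum>a | a \<in> units_mod q \<and> [a = y] (mod int r). g a) = (\<Sum>t<s. g (?f t))"
    by (rule sum.reindex_bij_betw[symmetric])
  moreover have "g (?f t) = g (y + int r * int t)" for t by (rule per) simp
  ultimately show ?thesis by simp
qed

lemma sum_powers_root_of_unity:
  fixes z :: complex
  assumes "z ^ N = 1"
  shows "(\<Sum>j<N. z ^ j) = (if z = 1 then of_nat N else 0)"
  using assms by (auto simp: geometric_sum)

section \<open>Additive characters\<close>

definition unity_char :: "nat \<Rightarrow> int \<Rightarrow> complex" where
  "unity_char q k = add_char (real_of_int k / real q)"

lemma add_char_eq_cis: "add_char x = cis (2 * pi * x)"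
  by (simp add: add_char_def cis_conv_exp mult_ac)

lemma unity_char_add: "unity_char q (k + l) = unity_char q k * unity_char q l"
  by (simp add: unity_char_def add_char_eq_cis cis_mult add_divide_distrib distrib_left)

lemma unity_char_0 [simp]: "unity_char q 0 = 1"
  by (simp add: unity_char_def add_char_def)

lemma norm_unity_char [simp]: "cmod (unity_char q k) = 1"
  by (simp add: unity_char_def add_char_eq_cis)

lemma unity_char_nonzero [simp]: "unity_char q k \<noteq> 0"
  using norm_unity_char[of q k] by (metis norm_zero zero_neq_one)

lemma cnj_unity_char: "cnj (unity_char q k) = unity_char q (- k)"
  by (simp add: unity_char_def add_char_eq_cis cis_cnj)

lemma unity_char_mult_nat: "unity_char q (k * int t) = unity_char q k ^ t"
  by (induction t) (simp_all add: distrib_left unity_char_add mult_ac)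

lemma unity_char_eq_1_iff:
  assumes "q > 0"
  shows "unity_char q k = 1 \<longleftrightarrow> int q dvd k"
proof
  assume "unity_char q k = 1"
  hence "cos (2 * pi * (real_of_int k / real q)) = 1"
    by (simp add: unity_char_def add_char_eq_cis complex_eq_iff)
  then obtain j :: int where "2 * pi * (real_of_int k / real q) = of_int j * 2 * pi"
    unfolding cos_one_2pi_int by blast
  hence "real_of_int k / real q = of_int j"
    using mult_left_cancel[of "2 * pi" "real_of_int k / real q" "of_int j"] by (simp add: mult_ac)
  hence "real_of_int k = of_int (int q * j)" using assms by (simp add: field_simps)
  hence "k = int q * j" using of_int_eq_iff by blast
  thus "int q dvd k" by simp
next
  assume "int q dvd k"
  then obtain j where j: "k = int q * j" by blast
  hence "real_of_int k / real q = of_int j" using assms by simp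
  thus "unity_char q k = 1"
    by (simp add: unity_char_def add_char_eq_cis complex_eq_iff cos_one_2pi_int sin_zero_iff_int2)
qed

lemma unity_char_cong:
  assumes "q > 0" "[k = l] (mod int q)"
  shows "unity_char q k = unity_char q l"
proof -
  have "unity_char q (k - l) = 1"
    using assms by (simp add: unity_char_eq_1_iff cong_iff_dvd_diff)
  thus ?thesis using unity_char_add[of q "k - l" l] by simp
qed

lemma unity_char_cancel:
  assumes "r > 0" "s > 0"
  shows "unity_char (r * s) (int r * k) = unity_char s k"
  using assms by (simp add: unity_char_def)

section \<open>Square roots of one\<close>

definition sqrts_one_mod :: "nat \<Rightarrow> int set" where
  "sqrts_one_mod q = {e \<in> {0..<int q}. [e\<^sup>2 = 1] (mod int q)}"

lemma finite_sqrts_one_mod [simp]: "finite (sqrts_one_mod q)"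
  by (rule finite_subset[of _ "{0..<int q}"]) (auto simp: sqrts_one_mod_def)

lemma coprime_if_square_cong_1:
  assumes "[e\<^sup>2 = 1] (mod m)"
  shows "coprime e (m::int)"
  using assms coprime_iff_invertible_int[of e m] by (auto simp: power2_eq_square)

text \<open>
  An odd prime \<open>p\<close> cannot divide both \<open>e - 1\<close> and \<open>e + 1\<close>, so a power of \<open>p\<close> that divides
  \<open>(e - 1) * (e + 1)\<close> divides one of the factors.
\<close>

lemma card_sqrts_one_mod_prime_power:
  assumes "prime p" "odd p" "k > 0"
  shows "card (sqrts_one_mod (p ^ k)) = 2"
proof -
  let ?m = "int p ^ k"
  have p2: "p > 2" using assms(1,2) prime_ge_2_nat[of p] by (cases "p = 2") auto
  have "p ^ 1 \<le> p ^ k" using assms(3) p2 by (intro power_increasing) auto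
  hence m2: "?m > 2" using p2 by (metis of_nat_less_iff of_nat_numeral of_nat_power order_less_le_trans power_one_right)
  have "sqrts_one_mod (p ^ k) = {1, ?m - 1}"
  proof (intro equalityI subsetI)
    fix e assume e: "e \<in> sqrts_one_mod (p ^ k)"
    hence bnd: "0 \<le> e" "e < ?m" and "[e\<^sup>2 = 1] (mod ?m)"
      by (auto simp: sqrts_one_mod_def)
    hence dv: "?m dvd (e - 1) * (e + 1)"
      by (simp add: cong_iff_dvd_diff power2_eq_square algebra_simps)
    show "e \<in> {1, ?m - 1}"
    proof (cases "int p dvd e + 1")
      case True
      have "\<not> int p dvd e - 1"
      proof
        assume "int p dvd e - 1"
        from dvd_diff[OF True this] have "int p dvd 2" by simp
        hence "int p \<le> 2" by (rule zdvd_imp_le) simp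
        thus False using p2 by simp
      qed
      hence "coprime ?m (e - 1)"
        using assms(1) by (simp add: prime_imp_coprime)
      hence "?m dvd e + 1" using dv by (simp add: coprime_dvd_mult_right_iff)
      hence "?m \<le> e + 1" using bnd by (intro zdvd_imp_le) auto
      thus ?thesis using bnd by auto
    next
      case False
      hence "coprime ?m (e + 1)"
        using assms(1) by (simp add: prime_imp_coprime)
      hence "?m dvd e - 1" using dv by (simp add: coprime_dvd_mult_left_iff)
      hence "[e = 1] (mod ?m)" by (simp add: cong_iff_dvd_diff)
      thus ?thesis using bnd m2 cong_less_imp_eq_int[of e ?m 1] by simp
    qed
  next
    fix e assume e: "e \<in> {1, ?m - 1}"
    have "1 \<in> sqrts_one_mod (p ^ k)" using m2 by (simp add: sqrts_one_mod_def)
    moreover have "(?m - 1)\<^sup>2 - 1 = ?m * (?m - 2)" by (simp add: power2_eq_square algebra_simps)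
    hence "[(?m - 1)\<^sup>2 = 1] (mod ?m)" by (simp add: cong_iff_dvd_diff)
    hence "?m - 1 \<in> sqrts_one_mod (p ^ k)" using m2 p2 by (simp add: sqrts_one_mod_def)
    ultimately show "e \<in> sqrts_one_mod (p ^ k)" using e by auto
  qed
  thus ?thesis using m2 by (simp add: card_insert_if)
qed

text \<open>
  This is the Chinese remainder theorem: reduction modulo the two factors is a bijection.
\<close>

lemma card_sqrts_one_mod_mult:
  assumes "coprime a b" "a > 0" "b > 0"
  shows "card (sqrts_one_mod (a * b)) = card (sqrts_one_mod a) * card (sqrts_one_mod b)"
proof -
  let ?f = "\<lambda>e. (e mod int a, e mod int b)"
  have "bij_betw ?f (sqrts_one_mod (a * b)) (sqrts_one_mod a \<times> sqrts_one_mod b)"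
    unfolding bij_betw_def
  proof
    show "inj_on ?f (sqrts_one_mod (a * b))"
    proof (rule inj_onI)
      fix x y assume xy: "x \<in> sqrts_one_mod (a * b)" "y \<in> sqrts_one_mod (a * b)" "?f x = ?f y"
      hence "[x = y] (mod int a)" "[x = y] (mod int b)" by (auto simp: cong_def)
      hence "[x = y] (mod int a * int b)" using assms(1) by (intro coprime_cong_mult) auto
      thus "x = y" using xy by (auto simp: sqrts_one_mod_def intro: cong_less_imp_eq_int)
    qed
    show "?f ` sqrts_one_mod (a * b) = sqrts_one_mod a \<times> sqrts_one_mod b"
    proof safe
      fix e assume e: "e \<in> sqrts_one_mod (a * b)"
      hence sq: "[e\<^sup>2 = 1] (mod int a * int b)" by (simp add: sqrts_one_mod_def)
      have "[e\<^sup>2 = 1] (mod int a)" "[e\<^sup>2 = 1] (mod int b)"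
        by (rule cong_dvd_modulus[OF sq], simp)+
      thus "e mod int a \<in> sqrts_one_mod a" "e mod int b \<in> sqrts_one_mod b"
        using assms by (auto simp: sqrts_one_mod_def cong_def power_mod)
    next
      fix x y assume x: "x \<in> sqrts_one_mod a" and y: "y \<in> sqrts_one_mod b"
      obtain z where z: "[z = x] (mod int a)" "[z = y] (mod int b)"
        using binary_chinese_remainder_int[of "int a" "int b" x y] assms(1) by auto
      define e where "e = z mod (int a * int b)"
      have ea: "[e = x] (mod int a)" using z(1)
        by (simp add: e_def cong_def mod_mod_cancel)
      have eb: "[e = y] (mod int b)" using z(2)
        by (simp add: e_def cong_def mod_mod_cancel)
      have "[e\<^sup>2 = 1] (mod int a)"
        using cong_trans[OF cong_pow[OF ea, of 2]] x by (auto simp: sqrts_one_mod_def)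
      moreover have "[e\<^sup>2 = 1] (mod int b)"
        using cong_trans[OF cong_pow[OF eb, of 2]] y by (auto simp: sqrts_one_mod_def)
      ultimately have "[e\<^sup>2 = 1] (mod int a * int b)" using assms(1) by (intro coprime_cong_mult) auto
      moreover have "0 \<le> e" "e < int a * int b" using assms by (simp_all add: e_def)
      ultimately have "e \<in> sqrts_one_mod (a * b)" by (simp add: sqrts_one_mod_def)
      moreover have "?f e = (x, y)"
        using ea eb x y by (auto simp: cong_def sqrts_one_mod_def)
      ultimately show "(x, y) \<in> ?f ` sqrts_one_mod (a * b)" by (simp add: image_iff) metis
    qed
  qed
  thus ?thesis by (simp add: bij_betw_same_card card_cartesian_product)
qed

lemma card_sqrts_one_mod:
  assumes "odd q"
  shows "card (sqrts_one_mod q) = 2 ^ num_prime_divisors q"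
  using assms
proof (induction q rule: less_induct)
  case (less q)
  show ?case
  proof (cases "q = 1")
    case True
    have "sqrts_one_mod 1 = {0}" by (auto simp: sqrts_one_mod_def)
    moreover have "{p::nat. prime p \<and> p dvd 1} = {}" by auto
    ultimately show ?thesis by (simp only: True num_prime_divisors_def card.empty) simp
  next
    case False
    have q0: "q > 0" using less.prems by (cases q) auto
    obtain p where p: "prime p" "p dvd q" using False by (metis prime_factor_nat)
    define k where "k = multiplicity p q"
    have "\<not> is_unit p" using p(1) by auto
    then obtain m where m: "q = p ^ k * m" "\<not> p dvd m"
      using multiplicity_decompose'[of q p] q0 unfolding k_def by auto
    have k: "k > 0" unfolding k_def using p q0
      by (metis multiplicity_eq_zero_iff \<open>\<not> is_unit p\<close> gr0I neq0_conv)
    have m0: "m > 0" using m q0 by (cases m) auto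
    have odd: "odd p" using less.prems p(2) dvd_trans by blast
    have oddm: "odd m" using less.prems m(1) by simp
    have cop: "coprime (p ^ k) m" using p(1) m(2) by (simp add: prime_imp_coprime)
    have "1 < p ^ k" using prime_gt_1_nat[OF p(1)] k by (rule one_less_power)
    hence "m < q" using m m0 by simp
    hence IH: "card (sqrts_one_mod m) = 2 ^ num_prime_divisors m" using less.IH oddm by blast
    have "{x. prime x \<and> x dvd q} = insert p {x. prime x \<and> x dvd m}"
    proof (intro equalityI subsetI)
      fix x assume "x \<in> {x. prime x \<and> x dvd q}"
      hence x: "prime x" "x dvd p ^ k * m" by (simp_all add: m(1))
      hence "x dvd p ^ k \<or> x dvd m" using prime_dvd_mult_iff by blast
      thus "x \<in> insert p {x. prime x \<and> x dvd m}"
        using x(1) primes_dvd_imp_eq[OF x(1) p(1)] prime_dvd_power[OF x(1)] by blast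
    next
      fix x assume "x \<in> insert p {x. prime x \<and> x dvd m}"
      thus "x \<in> {x. prime x \<and> x dvd q}" using p m(1) by auto
    qed
    moreover have "finite {x. prime x \<and> x dvd m}" using m0 by (intro finite_subset[OF _ finite_divisors_nat[of m]]) auto
    ultimately have "num_prime_divisors q = Suc (num_prime_divisors m)"
      using m(2) by (simp add: num_prime_divisors_def)
    thus ?thesis
      using card_sqrts_one_mod_mult[OF cop] card_sqrts_one_mod_prime_power[OF p(1) odd k] IH m0 p(1) m(1)
      by (simp add: prime_gt_0_nat)
  qed
qed

section \<open>Square-full moduli\<close>

text \<open>
  Take for \<open>d\<close> the squarefree part of \<open>q\<close>. A prime divisor \<open>p\<close> of \<open>d\<close> divides \<open>q\<close>, hence so does
  \<open>p\<^sup>2\<close>, and therefore \<open>p\<close> divides the square part \<open>r\<close>; as \<open>d\<close> is squarefree, this suffices.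
\<close>

lemma square_full_decomposition:
  assumes "square_full q"
  obtains r d where "q = r\<^sup>2 * d" "d dvd r" 
proof
  let ?r = "square_part q" and ?d = "squarefree_part q"
  show "q = ?r\<^sup>2 * ?d" using squarefree_decompose[of q] by (simp add: mult.commute)
  have q0: "q > 0" using assms by (simp add: square_full_def)
  have "multiplicity p ?d \<le> multiplicity p ?r" if p: "prime p" for p
  proof -
    show "multiplicity p ?d \<le> multiplicity p ?r"
    proof (cases "p dvd q")
      case True
      hence "p\<^sup>2 dvd q" using assms p by (simp add: square_full_def)
      hence "p dvd ?r" by (simp add: dvd_square_part_iff)
      hence "multiplicity p ?r \<ge> 1" using p q0
        by (metis Suc_leI One_nat_def gr0I multiplicity_eq_zero_iff not_prime_unit square_part_0_iff neq0_conv)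
      thus ?thesis using prime_multiplicity_squarefree_part_le_Suc_0[OF p, of q] by simp
    next
      case False
      hence "\<not> p dvd ?d" using squarefree_decompose[of q] by (metis dvd_mult2)
      thus ?thesis by (simp add: not_dvd_imp_multiplicity_0)
    qed
  qed
  thus "?d dvd ?r" using q0 by (subst prime_multiplicity_le_imp_dvd) simp_all
qed

text \<open>
  Both factors of \<open>x ^ r - 1 = (x - 1) * (\<Sum>i<r. x ^ i)\<close> vanish modulo \<open>r\<close>. This lifts roots of
  unity to higher moduli without solving any equation.
\<close>

lemma cong_1_power_modulus:
  fixes x :: int
  assumes "[x = 1] (mod int r)"
  shows "[x ^ r = 1] (mod (int r)\<^sup>2)"
proof -
  have "[(\<Sum>i<r. x ^ i) = (\<Sum>i<r. 1 ^ i)] (mod int r)"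
    by (rule cong_sum) (rule cong_pow[OF assms])
  hence "int r dvd (\<Sum>i<r. x ^ i)" by (simp add: cong_def dvd_eq_mod_eq_0)
  moreover have "int r dvd x - 1" using assms by (simp add: cong_iff_dvd_diff)
  ultimately have "int r * int r dvd (x - 1) * (\<Sum>i<r. x ^ i)" by (rule mult_dvd_mono[rotated])
  thus ?thesis by (simp add: cong_iff_dvd_diff power_diff_1_eq power2_eq_square)
qed

section \<open>Dirichlet characters and their orthogonality\<close>

lemma dirichlet_character_mult: "dirichlet_character q \<chi> \<Longrightarrow> \<chi> (a * b) = \<chi> a * \<chi> b"
  by (simp add: dirichlet_character_def)

lemma dirichlet_character_eq_0_iff:
  "dirichlet_character q \<chi> \<Longrightarrow> \<chi> a = 0 \<longleftrightarrow> \<not> coprime a (int q)"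
  unfolding dirichlet_character_def by blast

lemma dirichlet_character_cong:
  assumes "dirichlet_character q \<chi>" "[a = b] (mod int q)"
  shows "\<chi> a = \<chi> b"
proof -
  have shift: "\<chi> (x + int q * int k) = \<chi> x" for x k
  proof (induction k)
    case (Suc k)
    have "\<chi> (x + int q * int (Suc k)) = \<chi> ((x + int q * int k) + int q)"
      by (simp add: algebra_simps)
    also have "\<dots> = \<chi> x" using assms(1) Suc unfolding dirichlet_character_def by metis
    finally show ?case .
  qed simp
  obtain k where k: "b = a + int q * k" using assms(2) cong_iff_lin by blast
  show ?thesis
  proof (cases "k \<ge> 0")
    case True
    thus ?thesis using shift[of a "nat k"] k by simp
  next
    case False
    thus ?thesis using shift[of b "nat (- k)"] k by simp
  qed
qed

lemma dirichlet_character_1: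
  assumes "dirichlet_character q \<chi>"
  shows "\<chi> 1 = 1"
proof -
  have "\<chi> 1 \<noteq> 0" using dirichlet_character_eq_0_iff[OF assms, of 1] by simp
  moreover have "\<chi> 1 * \<chi> 1 = \<chi> 1" using dirichlet_character_mult[OF assms, of 1 1] by simp
  ultimately show ?thesis by simp
qed

lemma dirichlet_character_power:
  assumes "dirichlet_character q \<chi>"
  shows "\<chi> (a ^ k) = \<chi> a ^ k"
  by (induction k) (simp_all add: dirichlet_character_1[OF assms] dirichlet_character_mult[OF assms])

lemma euler_theorem_int:
  fixes a :: int
  assumes "q > 0" "coprime a (int q)"
  shows "[a ^ totient q = 1] (mod int q)"
proof -
  define b where "b = nat (a mod int q)"
  have b: "int b = a mod int q" using assms(1) by (simp add: b_def)
  have "coprime (int b) (int q)" unfolding b using assms by simp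
  hence "[b ^ totient q = 1] (mod q)" by (intro euler_theorem) simp
  hence "[int (b ^ totient q) = int 1] (mod int q)" by (simp only: cong_int_iff)
  hence "[int b ^ totient q = 1] (mod int q)" by simp
  thus ?thesis unfolding b by (simp add: cong_def power_mod)
qed

lemma dirichlet_character_power_totient:
  assumes "dirichlet_character q \<chi>" "q > 0" "coprime a (int q)"
  shows "\<chi> a ^ totient q = 1"
  using dirichlet_character_cong[OF assms(1) euler_theorem_int[OF assms(2,3)]]
  unfolding dirichlet_character_power[OF assms(1)] dirichlet_character_1[OF assms(1)] .

lemma norm_dirichlet_character:
  assumes "dirichlet_character q \<chi>" "q > 0" "coprime a (int q)"
  shows "cmod (\<chi> a) = 1"
proof -
  have "cmod (\<chi> a) ^ totient q = cmod (\<chi> a ^ totient q)" by (rule norm_power[symmetric])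
  also have "\<dots> = 1 ^ totient q" unfolding dirichlet_character_power_totient[OF assms] by simp
  finally show ?thesis
    by (rule power_eq_imp_eq_base) (use assms(2) in simp_all)
qed

text \<open>
  A character is determined by its values on \<open>{0..<q}\<close>, which are \<open>0\<close> or roots of unity of order
  dividing \<open>\<phi>(q)\<close>. Without finiteness, a sum over all characters would be \<open>0\<close> by convention.
\<close>

lemma finite_dirichlet_characters:
  assumes "q > 0"
  shows "finite {\<chi>. dirichlet_character q \<chi>}"
proof -
  let ?V = "insert 0 {z :: complex. z ^ totient q = 1}"
  let ?P = "{0..<int q} \<rightarrow>\<^sub>E ?V"
  have "totient q \<ge> 1" using assms by (simp add: Suc_leI)
  hence fin: "finite ?P" by (intro finite_PiE) (simp_all add: finite_roots_unity)
  have "{\<chi>. dirichlet_character q \<chi>} \<subseteq> (\<lambda>f a. f (a mod int q)) ` ?P"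
  proof
    fix \<chi> assume "\<chi> \<in> {\<chi>. dirichlet_character q \<chi>}"
    hence chi: "dirichlet_character q \<chi>" by simp
    have res: "restrict \<chi> {0..<int q} \<in> ?P"
      using dirichlet_character_power_totient[OF chi assms] dirichlet_character_eq_0_iff[OF chi]
      by auto
    have eq: "\<chi> = (\<lambda>a. restrict \<chi> {0..<int q} (a mod int q))"
    proof
      fix a
      have "\<chi> a = \<chi> (a mod int q)" by (rule dirichlet_character_cong[OF chi]) simp
      thus "\<chi> a = restrict \<chi> {0..<int q} (a mod int q)" using assms by simp
    qed
    show "\<chi> \<in> (\<lambda>f a. f (a mod int q)) ` ?P"
      by (rule image_eqI[where x = "restrict \<chi> {0..<int q}"]) (rule eq, rule res)
  qed
  thus ?thesis using fin finite_surj by blast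
qed

lemma dirichlet_character_principal: "dirichlet_character q (\<lambda>a. if coprime a (int q) then 1 else 0)"
proof -
  have "coprime (a + int q) (int q) \<longleftrightarrow> coprime a (int q)" for a
    by (rule coprime_cong_cong_left) (simp add: cong_def)
  thus ?thesis unfolding dirichlet_character_def by simp
qed

lemma dirichlet_character_times:
  "dirichlet_character q \<chi> \<Longrightarrow> dirichlet_character q \<psi> \<Longrightarrow> dirichlet_character q (\<lambda>a. \<chi> a * \<psi> a)"
  using dirichlet_character_mult[of q \<chi>] dirichlet_character_mult[of q \<psi>]
  unfolding dirichlet_character_def by simp

lemma dirichlet_character_cnj: "dirichlet_character q \<chi> \<Longrightarrow> dirichlet_character q (\<lambda>a. cnj (\<chi> a))"
  by (simp add: dirichlet_character_def)

text \<open>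
  If \<open>a\<close> differs from \<open>1\<close> modulo \<open>q\<close>, it already does so modulo the full power \<open>P\<close> of some prime
  that divides \<open>q\<close>. A primitive root \<open>g\<close> modulo \<open>P\<close> makes the units modulo \<open>P\<close> a cyclic group of order
  \<open>\<phi>(P)\<close>, on which the discrete logarithm followed by \<open>k \<mapsto> e(k / \<phi>(P))\<close> is an injective
  homomorphism.
\<close>

lemma exists_dirichlet_character_neq_1:
  assumes "odd q" and a: "coprime a (int q)" "\<not> [a = 1] (mod int q)"
  obtains \<chi> where "dirichlet_character q \<chi>" "\<chi> a \<noteq> 1"
proof -
  have q0: "q > 0" using assms(1) by (cases q) auto
  obtain p where p: "prime p" "\<not> [a = 1] (mod int (p ^ multiplicity p q))"
  proof (rule ccontr)
    assume "\<not> thesis"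
    with that have all: "[a = 1] (mod int (p ^ multiplicity p q))" if "prime p" for p
      using \<open>prime p\<close> by blast
    define m where "m = nat \<bar>a - 1\<bar>"
    have "int m = \<bar>a - 1\<bar>" by (simp add: m_def)
    hence dv: "[a = 1] (mod int k) \<longleftrightarrow> k dvd m" for k
      unfolding cong_iff_dvd_diff by (metis dvd_abs_iff int_dvd_int_iff)
    have "m \<noteq> 0" using a(2) dv[of q] by (cases m) auto
    moreover have "multiplicity p q \<le> multiplicity p m" if "prime p" for p
    proof (rule multiplicity_geI)
      show "p ^ multiplicity p q dvd m" using all[OF that] dv by blast
    qed (use \<open>m \<noteq> 0\<close> that in auto)
    ultimately have "q dvd m" using q0 by (subst prime_multiplicity_le_imp_dvd) auto
    thus False using a(2) dv by simp
  qed
  define k where "k = multiplicity p q"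
  define P where "P = p ^ k"
  have k: "k > 0" using p(2) unfolding k_def by (cases "multiplicity p q") auto
  have Pq: "P dvd q" unfolding P_def k_def by (rule multiplicity_dvd)
  have "p dvd P" using k unfolding P_def by (intro dvd_power) simp
  hence "p dvd q" using Pq by (rule dvd_trans)
  hence "odd p" using assms(1) dvd_trans[of 2 p q] by argo
  then obtain g where "\<forall>k>0. residue_primroot (p ^ k) g"
    using residue_primroot_odd_prime_power_exists[OF p(1)] by blast
  hence g: "residue_primroot P g" using k by (simp add: P_def)
  have P1: "P > 1" unfolding P_def using prime_gt_1_nat[OF p(1)] k by (rule one_less_power)
  have ord: "coprime P g" "ord P g = totient P" using g by (simp_all add: residue_primroot_def)
  \<comment> \<open>The discrete logarithm is only determined modulo \<open>\<phi>(P)\<close>; \<open>e_iff\<close> below absorbs the choice.\<close>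
  define ind where "ind x = (SOME i. [int g ^ i = x] (mod int P))" for x
  have ind: "[int g ^ ind x = x] (mod int P)" if "coprime x (int q)" for x
  proof -
    have "int P dvd int q" using Pq by simp
    hence "coprime x (int P)" using coprime_divisors[OF dvd_refl _ that] by blast
    hence "x mod int P \<in> units_mod P" using P1 by (intro mod_in_units_mod) auto
    then obtain y where y: "x mod int P = int y" "y < P" "coprime (int y) (int P)"
      unfolding units_mod_def by (auto elim: nonneg_int_cases)
    have "y \<noteq> 0"
    proof
      assume "y = 0"
      thus False using y(3) P1 by simp
    qed
    hence "y \<in> totatives P" using y by (simp add: in_totatives_iff)
    also have "totatives P = (\<lambda>i. g ^ i mod P) ` {..<totient P}"
      using residue_primroot_is_generator[OF P1 g] by (simp only: bij_betw_def)
    finally obtain i where "y = g ^ i mod P" by blast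
    hence "x mod int P = int (g ^ i mod P)" using y(1) by simp
    hence "[int g ^ i = x] (mod int P)" by (simp add: cong_def zmod_int)
    thus ?thesis unfolding ind_def by (rule someI)
  qed
  define e where "e j = unity_char (totient P) (int j)" for j
  have tot: "totient P > 0" using P1 by simp
  have e_iff: "e i = e j" if "[int g ^ i = int g ^ j] (mod int P)" for i j
  proof -
    have "[int (g ^ i) = int (g ^ j)] (mod int P)" using that by simp
    hence "[g ^ i = g ^ j] (mod P)" by (simp only: cong_int_iff)
    hence "[i = j] (mod totient P)" using order_divides_expdiff[OF ord(1)] ord(2) by simp
    thus ?thesis unfolding e_def using tot by (intro unity_char_cong) (simp_all add: cong_int_iff)
  qed
  \<comment> \<open>The character modulo \<open>P\<close> has to vanish on all non-units modulo \<open>q\<close>.\<close>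
  define \<chi> where "\<chi> x = (if coprime x (int q) then e (ind x) else 0)" for x
  have mult: "\<chi> (x * y) = \<chi> x * \<chi> y" for x y
  proof (cases "coprime x (int q) \<and> coprime y (int q)")
    case True
    hence xy: "coprime (x * y) (int q)" by simp
    have "[int g ^ ind (x * y) = x * y] (mod int P)" by (rule ind[OF xy])
    also have "[x * y = int g ^ ind x * int g ^ ind y] (mod int P)"
      using True by (intro cong_mult cong_sym[OF ind]) auto
    also have "int g ^ ind x * int g ^ ind y = int g ^ (ind x + ind y)" by (simp add: power_add)
    finally have "e (ind (x * y)) = e (ind x + ind y)" by (rule e_iff)
    thus ?thesis using True by (simp add: \<chi>_def e_def unity_char_add)
  qed (auto simp: \<chi>_def)
  have per: "\<chi> (x + int q) = \<chi> x" for x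
  proof -
    have c: "coprime (x + int q) (int q) \<longleftrightarrow> coprime x (int q)"
      by (rule coprime_cong_cong_left) (simp add: cong_def)
    show ?thesis
    proof (cases "coprime x (int q)")
      case True
      have "[x + int q = x] (mod int P)"
        using Pq by (simp add: cong_iff_dvd_diff)
      moreover have "[int g ^ ind (x + int q) = x + int q] (mod int P)"
        using True c by (intro ind) simp
      ultimately have "[int g ^ ind (x + int q) = int g ^ ind x] (mod int P)"
        using cong_sym[OF ind[OF True]] cong_trans by blast
      thus ?thesis using True c e_iff by (simp add: \<chi>_def)
    qed (simp add: \<chi>_def c)
  qed
  have nz: "\<chi> x \<noteq> 0 \<longleftrightarrow> coprime x (int q)" for x
  proof -
    show ?thesis by (simp add: \<chi>_def e_def)
  qed
  have "dirichlet_character q \<chi>" unfolding dirichlet_character_def using mult per nz by blast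
  moreover have "\<chi> a \<noteq> 1"
  proof
    assume "\<chi> a = 1"
    hence "totient P dvd ind a" using a(1) tot by (simp add: \<chi>_def e_def unity_char_eq_1_iff)
    hence "[g ^ ind a = 1] (mod P)" using ord_divides[of g "ind a" P] ord(2) by simp
    hence "[int (g ^ ind a) = int 1] (mod int P)" by (simp only: cong_int_iff)
    hence "[a = 1] (mod int P)" using cong_trans[OF cong_sym[OF ind[OF a(1)]]] by simp
    thus False using p(2) by (simp add: P_def k_def)
  qed
  ultimately show thesis by (rule that)
qed

text \<open>
  Multiplication by a character \<open>\<psi>\<close> with \<open>\<psi> a \<noteq> 1\<close> permutes the characters, and it multiplies the sum
  by \<open>\<psi> a\<close>.
\<close>

lemma sum_dirichlet_characters_eq_0:
  assumes "odd q" "coprime a (int q)" "\<not> [a = 1] (mod int q)"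
  shows "(\<Sum>\<chi> | dirichlet_character q \<chi>. \<chi> a) = 0"
proof -
  have q0: "q > 0" using assms(1) by (cases q) auto
  let ?X = "{\<chi>. dirichlet_character q \<chi>}"
  obtain \<psi> where psi: "dirichlet_character q \<psi>" "\<psi> a \<noteq> 1"
    using exists_dirichlet_character_neq_1[OF assms] .
  have inv: "\<psi> x * (cnj (\<psi> x) * \<chi> x) = \<chi> x" if "dirichlet_character q \<chi>" for \<chi> x
  proof (cases "coprime x (int q)")
    case True
    have "\<psi> x * cnj (\<psi> x) = 1"
      using norm_dirichlet_character[OF psi(1) q0 True] by (simp flip: complex_norm_square)
    thus ?thesis by (simp flip: mult.assoc)
  qed (use dirichlet_character_eq_0_iff[OF that] in auto)
  have "bij_betw (\<lambda>\<chi> x. \<psi> x * \<chi> x) ?X ?X"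
  proof (rule bij_betw_byWitness[where f' = "\<lambda>\<chi> x. cnj (\<psi> x) * \<chi> x"])
    show "\<forall>\<chi>\<in>?X. (\<lambda>x. cnj (\<psi> x) * (\<psi> x * \<chi> x)) = \<chi>"
      unfolding mult.left_commute[of "cnj _"] by (intro ballI ext) (rule inv, simp)
    show "\<forall>\<chi>\<in>?X. (\<lambda>x. \<psi> x * (cnj (\<psi> x) * \<chi> x)) = \<chi>"
      by (intro ballI ext) (rule inv, simp)
    show "(\<lambda>\<chi> x. \<psi> x * \<chi> x) ` ?X \<subseteq> ?X"
      using dirichlet_character_times[OF psi(1)] by blast
    show "(\<lambda>\<chi> x. cnj (\<psi> x) * \<chi> x) ` ?X \<subseteq> ?X"
      using dirichlet_character_times[OF dirichlet_character_cnj[OF psi(1)]] by blast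
  qed
  from sum.reindex_bij_betw[OF this, of "\<lambda>\<chi>. \<chi> a"]
  have "\<psi> a * (\<Sum>\<chi>\<in>?X. \<chi> a) = (\<Sum>\<chi>\<in>?X. \<chi> a)" by (simp add: sum_distrib_left)
  thus ?thesis using psi(2) by simp
qed

lemma sum_units_mod_dirichlet_character:
  assumes "q > 0" "dirichlet_character q \<chi>"
  shows "(\<Sum>a\<in>units_mod q. \<chi> a) =
    (if \<chi> = (\<lambda>a. if coprime a (int q) then 1 else 0) then of_nat (card (units_mod q)) else 0)"
proof (cases "\<chi> = (\<lambda>a. if coprime a (int q) then 1 else 0)")
  case True
  thus ?thesis by (auto simp: units_mod_def)
next
  case False
  then obtain u where u: "\<chi> u \<noteq> (if coprime u (int q) then 1 else 0)" by blast
  hence cop: "coprime u (int q)" and u1: "\<chi> u \<noteq> 1"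
    using dirichlet_character_eq_0_iff[OF assms(2), of u] by (auto split: if_splits)
  have "(\<Sum>a\<in>units_mod q. \<chi> (u * a)) = (\<Sum>a\<in>units_mod q. \<chi> a)"
    using assms(1) cop dirichlet_character_cong[OF assms(2)] by (rule sum_units_mod_mult)
  hence "\<chi> u * (\<Sum>a\<in>units_mod q. \<chi> a) = (\<Sum>a\<in>units_mod q. \<chi> a)"
    by (simp add: dirichlet_character_mult[OF assms(2)] sum_distrib_left)
  thus ?thesis using u1 False by simp
qed

text \<open>
  The value at \<open>1\<close>, which is the number of characters, follows from the vanishing everywhere else.
  It is the sum of \<open>\<chi> b\<close> over all \<open>\<chi>\<close> and all units \<open>b\<close>, and when the sum over \<open>b\<close> is taken
  first, only the principal character contributes, with \<open>\<phi>(q)\<close>.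
\<close>

theorem sum_dirichlet_characters:
  assumes "odd q" "q > 1" "a \<in> units_mod q"
  shows "(\<Sum>\<chi> | dirichlet_character q \<chi>. \<chi> a) = (if a = 1 then of_nat (totient q) else 0)"
proof -
  let ?X = "{\<chi>. dirichlet_character q \<chi>}" and ?p = "\<lambda>a. if coprime a (int q) then 1 else (0::complex)"
  have fin: "finite ?X" using assms(2) by (intro finite_dirichlet_characters) simp
  have one: "1 \<in> units_mod q" using assms(2) by (simp add: units_mod_def)
  have off: "(\<Sum>\<chi>\<in>?X. \<chi> b) = 0" if "b \<in> units_mod q" "b \<noteq> 1" for b
    using that units_mod_cong_imp_eq[OF that(1) one] assms(1) units_modD[OF that(1)]
    by (intro sum_dirichlet_characters_eq_0) auto
  have "(\<Sum>b\<in>units_mod q. \<Sum>\<chi>\<in>?X. \<chi> b) = (\<Sum>\<chi>\<in>?X. \<Sum>b\<in>units_mod q. \<chi> b)"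
    by (rule sum.swap)
  also have "\<dots> = (\<Sum>\<chi>\<in>?X. if \<chi> = ?p then of_nat (card (units_mod q)) else 0)"
    using assms(2) by (intro sum.cong sum_units_mod_dirichlet_character) auto
  also have "\<dots> = of_nat (totient q)"
    using fin dirichlet_character_principal[of q] card_units_mod[OF assms(2)] by (simp add: sum.delta)
  finally have "of_nat (totient q) = (\<Sum>b\<in>units_mod q. \<Sum>\<chi>\<in>?X. \<chi> b)" by simp
  also have "\<dots> = (\<Sum>b\<in>{1}. \<Sum>\<chi>\<in>?X. \<chi> b)"
    using one off by (intro sum.mono_neutral_right) auto
  finally show ?thesis using off assms(3) by simp
qed

section \<open>The second moment of quadratic Gauss sums\<close>

definition gauss_term :: "nat \<Rightarrow> int \<Rightarrow> (int \<Rightarrow> complex) \<Rightarrow> int \<Rightarrow> complex" where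
  "gauss_term q n \<chi> a = \<chi> a * unity_char q (n * a\<^sup>2)"

lemma gauss_term_cong:
  assumes "dirichlet_character q \<chi>" "q > 0" "[a = b] (mod int q)"
  shows "gauss_term q n \<chi> a = gauss_term q n \<chi> b"
proof -
  have "[n * a\<^sup>2 = n * b\<^sup>2] (mod int q)" using assms(3) by (intro cong_scalar_left cong_pow)
  thus ?thesis
    using unity_char_cong[OF assms(2)] dirichlet_character_cong[OF assms(1,3)] by (simp add: gauss_term_def)
qed

lemma quad_gauss_sum_eq:
  assumes "dirichlet_character q \<chi>" "q > 1"
  shows "quad_gauss_sum n \<chi> q = (\<Sum>a\<in>units_mod q. gauss_term q n \<chi> a)"
proof -
  have sub: "units_mod q \<subseteq> {1..int q}"
  proof
    fix a assume a: "a \<in> units_mod q"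
    hence "a \<noteq> 0" using assms(2) by (auto simp: units_mod_def)
    thus "a \<in> {1..int q}" using a by (auto simp: units_mod_def)
  qed
  have "quad_gauss_sum n \<chi> q = (\<Sum>a\<in>{1..int q}. gauss_term q n \<chi> a)"
    by (simp add: quad_gauss_sum_def gauss_term_def unity_char_def)
  also have "\<dots> = (\<Sum>a\<in>units_mod q. gauss_term q n \<chi> a)"
  proof (rule sum.mono_neutral_right[OF _ sub], simp, intro ballI)
    fix a assume "a \<in> {1..int q} - units_mod q"
    hence a: "a \<in> {1..int q}" "a \<notin> units_mod q" by simp_all
    have "\<not> coprime a (int q)"
    proof
      assume c: "coprime a (int q)"
      hence "a \<noteq> int q" using assms(2) by auto
      thus False using a c by (auto simp: units_mod_def)
    qed
    thus "gauss_term q n \<chi> a = 0"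
      using dirichlet_character_eq_0_iff[OF assms(1)] by (simp add: gauss_term_def)
  qed
  finally show ?thesis .
qed

lemma gauss_term_ratio:
  assumes "dirichlet_character q \<chi>" "q > 0" "coprime b (int q)"
  shows "gauss_term q n \<chi> (b * u) * cnj (gauss_term q n \<chi> b) = \<chi> u * unity_char q (n * b\<^sup>2 * (u\<^sup>2 - 1))"
proof -
  have 1: "\<chi> b * cnj (\<chi> b) = 1"
    using norm_dirichlet_character[OF assms] by (simp flip: complex_norm_square)
  have 2: "unity_char q (n * b\<^sup>2 * (u\<^sup>2 - 1)) = unity_char q (n * (b * u)\<^sup>2) * unity_char q (- (n * b\<^sup>2))"
    by (simp add: algebra_simps flip: unity_char_add)
  have "gauss_term q n \<chi> (b * u) * cnj (gauss_term q n \<chi> b) =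
     (\<chi> b * cnj (\<chi> b)) * \<chi> u * (unity_char q (n * (b * u)\<^sup>2) * unity_char q (- (n * b\<^sup>2)))"
    by (simp add: gauss_term_def cnj_unity_char dirichlet_character_mult[OF assms(1)])
  thus ?thesis unfolding 1 2 by simp
qed

text \<open>
  Expand the square of the sum over the residue class of \<open>y\<close> modulo \<open>r\<close> as a double sum over \<open>a\<close>
  and \<open>b\<close> and substitute \<open>a = b * u\<close>. The values of \<open>\<chi>\<close> at \<open>b\<close> cancel, so the inner sum is
  purely additive. The case \<open>r = 1\<close> gives the full Gauss sum, the other cases serve for the
  stationary points.
\<close>

lemma norm_square_gauss_residue_class:
  fixes n :: int
  assumes "dirichlet_character q \<chi>" "q > 0" "r dvd q"
    and y: "coprime y (int q)"
  defines "T \<equiv> (\<Sum>a | a \<in> units_mod q \<and> [a = y] (mod int r). gauss_term q n \<chi> a)"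
  shows "T * cnj T = (\<Sum>u | u \<in> units_mod q \<and> [u = 1] (mod int r).
     \<chi> u * (\<Sum>b | b \<in> units_mod q \<and> [b = y] (mod int r). unity_char q (n * b\<^sup>2 * (u\<^sup>2 - 1))))"
proof -
  let ?F = "gauss_term q n \<chi>" and ?U = "units_mod q"
  let ?Y = "{b. b \<in> ?U \<and> [b = y] (mod int r)}" and ?I = "{u. u \<in> ?U \<and> [u = 1] (mod int r)}"
  have T: "T = (\<Sum>u\<in>?I. ?F (b * u))" if b: "b \<in> ?Y" for b
  proof -
    have cop: "coprime b (int q)" using b by (auto dest: units_modD)
    have iff: "[b * u = y] (mod int r) \<longleftrightarrow> [u = 1] (mod int r)" for u
    proof -
      have "coprime b (int r)" using cop assms(3) by (metis coprime_divisors dvd_refl int_dvd_int_iff)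
      hence "[b * u = b * 1] (mod int r) \<longleftrightarrow> [u = 1] (mod int r)" by (rule cong_mult_lcancel)
      moreover have "[b * u = b * 1] (mod int r) \<longleftrightarrow> [b * u = y] (mod int r)"
        using b by (auto simp: cong_def)
      ultimately show ?thesis by simp
    qed
    have "T = (\<Sum>a\<in>?U. if [a = y] (mod int r) then ?F a else 0)"
      unfolding T_def by (simp add: sum.inter_filter)
    also have "\<dots> = (\<Sum>u\<in>?U. if [b * u = y] (mod int r) then ?F (b * u) else 0)"
    proof (rule sum_units_mod_mult[OF assms(2) cop, symmetric])
      fix a a' assume aa: "[a = a'] (mod int q)"
      hence "[a = a'] (mod int r)" using assms(3) by (intro cong_dvd_modulus[OF aa]) simp
      thus "(if [a = y] (mod int r) then ?F a else 0) = (if [a' = y] (mod int r) then ?F a' else 0)"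
        using gauss_term_cong[OF assms(1,2) aa] by (auto simp: cong_def)
    qed
    also have "\<dots> = (\<Sum>u\<in>?I. ?F (b * u))" by (simp add: iff sum.inter_filter)
    finally show ?thesis .
  qed
  have "T * cnj T = (\<Sum>b\<in>?Y. T * cnj (?F b))" by (simp add: T_def sum_distrib_left)
  also have "\<dots> = (\<Sum>b\<in>?Y. \<Sum>u\<in>?I. ?F (b * u) * cnj (?F b))"
    by (intro sum.cong refl) (simp add: T sum_distrib_right)
  also have "\<dots> = (\<Sum>b\<in>?Y. \<Sum>u\<in>?I. \<chi> u * unity_char q (n * b\<^sup>2 * (u\<^sup>2 - 1)))"
    using gauss_term_ratio[OF assms(1,2)] by (intro sum.cong refl) (auto dest: units_modD)
  also have "\<dots> = (\<Sum>u\<in>?I. \<Sum>b\<in>?Y. \<chi> u * unity_char q (n * b\<^sup>2 * (u\<^sup>2 - 1)))"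
    by (rule sum.swap)
  finally show ?thesis by (simp add: sum_distrib_left)
qed

text \<open>
  In the expansion of \<open>|G \<chi>|\<^sup>2\<close> the summation over \<open>\<chi>\<close> selects \<open>u = 1\<close>, where every additive
  character value is \<open>1\<close>.
\<close>

theorem second_moment_quad_gauss_sum:
  assumes "odd q" "q > 1"
  shows "(\<Sum>\<chi> | dirichlet_character q \<chi>. (cmod (quad_gauss_sum n \<chi> q))\<^sup>2) = (real (totient q))\<^sup>2"
proof -
  let ?X = "{\<chi>. dirichlet_character q \<chi>}" and ?U = "units_mod q"
  define W where "W u = (\<Sum>b\<in>?U. unity_char q (n * b\<^sup>2 * (u\<^sup>2 - 1)))" for u
  have one: "1 \<in> ?U" using assms(2) by (simp add: units_mod_def)
  have sq: "complex_of_real ((cmod (quad_gauss_sum n \<chi> q))\<^sup>2) = (\<Sum>u\<in>?U. \<chi> u * W u)" if "\<chi> \<in> ?X" for \<chi>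
    using norm_square_gauss_residue_class[of q \<chi> 1 1 n] that assms(2)
    by (simp add: quad_gauss_sum_eq complex_norm_square W_def del: of_real_power)
  have "complex_of_real (\<Sum>\<chi>\<in>?X. (cmod (quad_gauss_sum n \<chi> q))\<^sup>2) = (\<Sum>\<chi>\<in>?X. \<Sum>u\<in>?U. \<chi> u * W u)"
    unfolding of_real_sum by (intro sum.cong refl sq)
  also have "\<dots> = (\<Sum>u\<in>?U. \<Sum>\<chi>\<in>?X. \<chi> u * W u)" by (rule sum.swap)
  also have "\<dots> = (\<Sum>u\<in>?U. (if u = 1 then of_nat (totient q) else 0) * W u)"
    by (intro sum.cong refl) (simp add: sum_dirichlet_characters[OF assms] flip: sum_distrib_right)
  also have "\<dots> = (\<Sum>u\<in>?U. if u = 1 then of_nat (totient q) * W u else 0)"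
    by (intro sum.cong) auto
  also have "\<dots> = of_nat (totient q) * W 1" using one by (simp add: sum.delta)
  also have "W 1 = of_nat (totient q)" by (simp add: W_def card_units_mod[OF assms(2)])
  finally have "complex_of_real (\<Sum>\<chi>\<in>?X. (cmod (quad_gauss_sum n \<chi> q))\<^sup>2) = complex_of_real ((real (totient q))\<^sup>2)"
    by (simp add: power2_eq_square)
  thus ?thesis using of_real_eq_iff by blast
qed

section \<open>Stationary phase modulo a square-full number\<close>

text \<open>
  Every square-full \<open>q\<close> has this shape (\<open>square_full_decomposition\<close>). What the shape provides is
  that \<open>r\<close> has the same prime divisors as \<open>q\<close>, while \<open>q\<close> divides both \<open>(r * d)\<^sup>2\<close> and \<open>r ^ 3\<close>, so
  expansions around a residue class modulo \<open>r * d\<close> are linear, and those modulo \<open>r\<close> are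
  quadratic.
\<close>

locale square_full_gauss =
  fixes q r d :: nat and n :: int and \<chi> :: "int \<Rightarrow> complex"
  assumes q_eq: "q = r\<^sup>2 * d" and d_dvd_r: "d dvd r" and odd_q: "odd q"
    and coprime_n: "coprime n (int q)" and char: "dirichlet_character q \<chi>"
begin

abbreviation "F \<equiv> gauss_term q n \<chi>"

text \<open>
  By \<open>gauss_term_mult_w\<close> the substitution of \<open>w * a\<close> for \<open>a\<close> multiplies \<open>F a\<close> by \<open>z a\<close>. The
  additive factor of \<open>z\<close> comes from \<open>w\<^sup>2 \<equiv> 1 + 2 * r * d\<close> modulo \<open>q\<close>.
\<close>

definition w :: int where "w = 1 + int r * int d"

definition z :: "int \<Rightarrow> complex" where "z a = \<chi> w * unity_char r (2 * n * a\<^sup>2)"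

lemma pos: "q > 0" "r > 0" "d > 0"
  using odd_q by (auto simp: q_eq intro!: Nat.gr0I)

lemma q_dvd: "int q dvd int r ^ 3"
proof -
  have "int r ^ 2 * int d dvd int r ^ 2 * int r" using d_dvd_r by (intro mult_dvd_mono) auto
  thus ?thesis by (simp add: q_eq power3_eq_cube power2_eq_square)
qed

lemma coprime_lift: "coprime a (int r) \<Longrightarrow> coprime a (int q)"
proof -
  assume a: "coprime a (int r)"
  hence "coprime a (int d)" using d_dvd_r by (metis coprime_divisors dvd_refl int_dvd_int_iff)
  thus ?thesis using a by (simp add: q_eq)
qed

lemma coprime_lower: "coprime a (int q) \<Longrightarrow> coprime a (int r)" "coprime a (int q) \<Longrightarrow> coprime a (int d)"
  using pos by (simp_all add: q_eq)

lemma coprime_2_q: "coprime 2 (int q)"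
  using odd_q by simp

lemma gauss_term_nonzero: "coprime a (int q) \<Longrightarrow> F a \<noteq> 0"
  using dirichlet_character_eq_0_iff[OF char, of a] norm_unity_char[of q "n * a\<^sup>2"]
  by (auto simp: gauss_term_def)

lemma coprime_w: "coprime w (int q)"
proof (rule coprime_lift)
  have "[1 = w] (mod int r)" by (simp add: w_def cong_def)
  thus "coprime w (int r)" using coprime_cong_transfer_left[of 1 "int r" w] by simp
qed

lemma z_cong:
  assumes "[a\<^sup>2 = b\<^sup>2] (mod int r)"
  shows "z a = z b"
  using unity_char_cong[OF pos(2) cong_scalar_left[OF assms, of "2 * n"]] by (simp add: z_def)

lemma gauss_term_mult_w: "F (w * a) = F a * z a"
proof -
  have "n * (w * a)\<^sup>2 - (n * a\<^sup>2 + int r * int d * (2 * n * a\<^sup>2)) = int q * (int d * n * a\<^sup>2)"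
    by (simp add: w_def q_eq power2_eq_square algebra_simps)
  hence "[n * (w * a)\<^sup>2 = n * a\<^sup>2 + int r * int d * (2 * n * a\<^sup>2)] (mod int q)"
    by (simp add: cong_iff_dvd_diff)
  hence "unity_char q (n * (w * a)\<^sup>2) = unity_char q (n * a\<^sup>2) * unity_char q (int r * int d * (2 * n * a\<^sup>2))"
    using unity_char_cong[OF pos(1)] by (simp add: unity_char_add)
  also have "unity_char q (int r * int d * (2 * n * a\<^sup>2)) = unity_char r (2 * n * a\<^sup>2)"
    using unity_char_cancel[of "r * d" r "2 * n * a\<^sup>2"] pos by (simp add: q_eq power2_eq_square mult_ac)
  finally show ?thesis by (simp add: gauss_term_def z_def dirichlet_character_mult[OF char])
qed

lemma gauss_term_mult_w_power: "F (w ^ j * a) = F a * z a ^ j"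
proof (induction j)
  case (Suc j)
  have "[w ^ j = 1 ^ j] (mod int r)" by (rule cong_pow) (simp add: w_def cong_def)
  hence "[(w ^ j * a)\<^sup>2 = (1 * a)\<^sup>2] (mod int r)" by (intro cong_pow cong_scalar_right) simp
  hence "z (w ^ j * a) = z a" using z_cong by simp
  thus ?case using gauss_term_mult_w[of "w ^ j * a"] Suc by (simp add: mult_ac)
qed simp

lemma z_power_totient:
  assumes "coprime a (int q)"
  shows "z a ^ totient q = 1"
proof -
  have "[w ^ totient q * a = 1 * a] (mod int q)"
    using euler_theorem_int[OF pos(1) coprime_w] by (rule cong_scalar_right)
  hence "F (w ^ totient q * a) = F a" using gauss_term_cong[OF char pos(1)] by simp
  thus ?thesis using gauss_term_nonzero[OF assms] by (simp add: gauss_term_mult_w_power)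
qed

text \<open>
  The substitution of \<open>w ^ j * a\<close> for \<open>a\<close> preserves the sum for every \<open>j\<close>. On average over \<open>\<phi>(q)\<close>
  values of \<open>j\<close>, the summand at \<open>a\<close> is multiplied by the mean of the powers of the root of unity
  \<open>z a\<close>, which is \<open>0\<close> unless \<open>z a = 1\<close>.
\<close>

lemma sum_gauss_term_stationary: "(\<Sum>a\<in>units_mod q. F a) = (\<Sum>a | a \<in> units_mod q \<and> z a = 1. F a)"
proof -
  let ?N = "totient q"
  have shift: "(\<Sum>a\<in>units_mod q. F a) = (\<Sum>a\<in>units_mod q. F (w ^ j * a))" for j
    using sum_units_mod_mult[OF pos(1), of "w ^ j" F] coprime_w gauss_term_cong[OF char pos(1)] by simp
  have "of_nat ?N * (\<Sum>a\<in>units_mod q. F a) = (\<Sum>j<?N. \<Sum>a\<in>units_mod q. F (w ^ j * a))"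
    by (simp flip: shift)
  also have "\<dots> = (\<Sum>a\<in>units_mod q. F a * (\<Sum>j<?N. z a ^ j))"
    by (subst sum.swap) (simp add: gauss_term_mult_w_power sum_distrib_left)
  also have "\<dots> = (\<Sum>a\<in>units_mod q. of_nat ?N * (if z a = 1 then F a else 0))"
    by (intro sum.cong refl) (simp add: sum_powers_root_of_unity z_power_totient units_modD)
  also have "\<dots> = of_nat ?N * (\<Sum>a | a \<in> units_mod q \<and> z a = 1. F a)"
    by (simp add: sum.inter_filter flip: sum_distrib_left)
  finally show ?thesis using pos by simp
qed

lemma z_eq_imp_cong:
  assumes "z a = z b"
  shows "[a\<^sup>2 = b\<^sup>2] (mod int r)"
proof -
  have "\<chi> w \<noteq> 0" using dirichlet_character_eq_0_iff[OF char] coprime_w by blast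
  hence eq: "unity_char r (2 * n * a\<^sup>2) = unity_char r (2 * n * b\<^sup>2)" using assms by (simp add: z_def)
  have "unity_char r (2 * n * a\<^sup>2 - 2 * n * b\<^sup>2) * unity_char r (2 * n * b\<^sup>2) = unity_char r (2 * n * b\<^sup>2)"
    by (simp add: eq flip: unity_char_add)
  moreover have "unity_char r (2 * n * b\<^sup>2) \<noteq> 0" by simp
  ultimately have "unity_char r (2 * n * a\<^sup>2 - 2 * n * b\<^sup>2) = 1" by simp
  hence "[2 * n * a\<^sup>2 = 2 * n * b\<^sup>2] (mod int r)"
    using pos by (simp add: unity_char_eq_1_iff cong_iff_dvd_diff)
  moreover have "coprime (2 * n) (int r)"
    by (rule coprime_lower) (use coprime_n coprime_2_q in simp)
  ultimately show ?thesis using cong_mult_lcancel by blast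
qed

text \<open>
  Put \<open>u = 1 + r * h\<close> and \<open>b = y + r * t\<close> in the expansion of the square, with \<open>h\<close> and \<open>t\<close> running
  modulo \<open>R = r * d\<close>. Terms with \<open>r ^ 3\<close> disappear modulo \<open>q\<close>, so \<open>n * b\<^sup>2 * (u\<^sup>2 - 1)\<close> is
  linear in \<open>t\<close>, with slope \<open>4 * n * y * r\<^sup>2 * h\<close>. The sum over \<open>t\<close> therefore vanishes unless \<open>d\<close>
  divides \<open>h\<close>. In that case \<open>u\<close> is a power of \<open>w\<close>, so the remaining term is \<open>1\<close> by stationarity
  of \<open>y\<close>. There are \<open>r\<close> such \<open>h\<close>, and the total is \<open>r * R = q\<close>.
\<close>

lemma norm_square_stationary_class:
  assumes y: "coprime y (int q)" "z y = 1"
  defines "T \<equiv> (\<Sum>a | a \<in> units_mod q \<and> [a = y] (mod int r). F a)"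
  shows "T * cnj T = of_nat q"
proof -
  define R where "R = r * d"
  have qR: "q = r * R" by (simp add: R_def q_eq power2_eq_square)
  define u where "u h = 1 + int r * int h" for h :: nat
  define E where "E b v = unity_char q (n * b\<^sup>2 * (v\<^sup>2 - 1))" for b v
  have E_cong1: "E b v = E b' v" if "[b = b'] (mod int q)" for b b' v
    unfolding E_def using that by (intro unity_char_cong pos cong_mult cong_pow cong_refl)
  have E_cong2: "E b v = E b v'" if "[v = v'] (mod int q)" for b v v'
    unfolding E_def using that by (intro unity_char_cong pos cong_mult cong_diff cong_pow cong_refl)
  have expand: "E (y + int r * int t) (u h) = E y (u h) * unity_char d (4 * n * y * int h) ^ t" for t h
  proof -
    have "n * (y + int r * int t)\<^sup>2 * ((u h)\<^sup>2 - 1) -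
          (n * y\<^sup>2 * ((u h)\<^sup>2 - 1) + int r ^ 2 * (4 * n * y * int h * int t)) =
          int r ^ 3 * (n * (2 * y * int t * int h ^ 2 + 2 * int t ^ 2 * int h + int r * int t ^ 2 * int h ^ 2))"
      by (simp add: u_def power2_eq_square power3_eq_cube algebra_simps)
    hence "[n * (y + int r * int t)\<^sup>2 * ((u h)\<^sup>2 - 1) =
          n * y\<^sup>2 * ((u h)\<^sup>2 - 1) + int r ^ 2 * (4 * n * y * int h * int t)] (mod int q)"
      unfolding cong_iff_dvd_diff using q_dvd by (metis dvd_mult2)
    hence "E (y + int r * int t) (u h) = E y (u h) * unity_char q (int r ^ 2 * (4 * n * y * int h * int t))"
      unfolding E_def using unity_char_cong[OF pos(1)] by (simp add: unity_char_add)
    also have "unity_char q (int r ^ 2 * (4 * n * y * int h * int t)) = unity_char d (4 * n * y * int h * int t)"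
      using unity_char_cancel[of "r\<^sup>2" d] pos by (simp add: q_eq)
    finally show ?thesis by (simp add: unity_char_mult_nat)
  qed
  have inner: "(\<Sum>t<R. E (y + int r * int t) (u h)) = (if d dvd h then of_nat R * E y (u h) else 0)" for h
  proof -
    let ?c = "unity_char d (4 * n * y * int h)"
    have "coprime (2 * (2 * (n * y))) (int d)"
      using coprime_n coprime_2_q y(1) by (intro coprime_lower) (simp only: coprime_mult_left_iff)
    hence "coprime (4 * n * y) (int d)" by (simp only: mult.assoc[symmetric]) simp
    hence "int d dvd (4 * n * y) * int h \<longleftrightarrow> int d dvd int h"
      by (intro coprime_dvd_mult_right_iff) (simp add: coprime_commute)
    hence c1: "?c = 1 \<longleftrightarrow> d dvd h" using pos by (simp add: unity_char_eq_1_iff)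
    have "?c ^ R = unity_char d (4 * n * y * int h * int R)" by (rule unity_char_mult_nat[symmetric])
    also have "\<dots> = 1" using pos by (simp add: unity_char_eq_1_iff R_def)
    finally have "(\<Sum>t<R. ?c ^ t) = (if d dvd h then of_nat R else 0)"
      using sum_powers_root_of_unity c1 by simp
    thus ?thesis by (simp add: expand flip: sum_distrib_left)
  qed
  have diag: "\<chi> (u h) * E y (u h) = 1" if "d dvd h" for h
  proof -
    obtain s where s: "h = d * s" using \<open>d dvd h\<close> by blast
    have "[w ^ s = u (d * s)] (mod int q)" for s
    proof (induction s)
      case (Suc s)
      have "[w * w ^ s = w * u (d * s)] (mod int q)" by (rule cong_scalar_left[OF Suc])
      also have "w * u (d * s) - u (d * Suc s) = int q * (int d * int s)"
        by (simp add: w_def u_def q_eq power2_eq_square algebra_simps)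
      hence "[w * u (d * s) = u (d * Suc s)] (mod int q)" by (simp add: cong_iff_dvd_diff)
      finally show ?case by simp
    qed (simp add: u_def)
    hence "[w ^ s * y = u h * y] (mod int q)" unfolding s by (rule cong_scalar_right)
    from gauss_term_cong[OF char pos(1) this] have "F (y * u h) = F (w ^ s * y)"
      by (simp add: mult.commute)
    also have "\<dots> = F (y * 1)" by (simp add: gauss_term_mult_w_power y(2))
    finally have "\<chi> (u h) * E y (u h) = F (y * 1) * cnj (F y)"
      using gauss_term_ratio[OF char pos(1) y(1), of n "u h"] by (simp add: E_def)
    also have "\<dots> = 1"
      using gauss_term_ratio[OF char pos(1) y(1), of n 1] by (simp add: dirichlet_character_1[OF char])
    finally show ?thesis .
  qed
  have "T * cnj T = (\<Sum>v | v \<in> units_mod q \<and> [v = 1] (mod int r). \<chi> v *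
      (\<Sum>b | b \<in> units_mod q \<and> [b = y] (mod int r). E b v))"
    unfolding T_def E_def using y(1)
    by (intro norm_square_gauss_residue_class char pos) (simp_all add: qR)
  also have "\<dots> = (\<Sum>v | v \<in> units_mod q \<and> [v = 1] (mod int r). \<chi> v * (\<Sum>t<R. E (y + int r * int t) v))"
    using sum_units_mod_residue_class[OF qR pos(1) y(1) coprime_lift E_cong1] by simp
  also have "\<dots> = (\<Sum>h<R. \<chi> (u h) * (\<Sum>t<R. E (y + int r * int t) (u h)))"
  proof -
    have "\<chi> v * (\<Sum>t<R. E (y + int r * int t) v) = \<chi> v' * (\<Sum>t<R. E (y + int r * int t) v')"
      if "[v = v'] (mod int q)" for v v'
      using E_cong2[OF that] dirichlet_character_cong[OF char that] by simp
    from sum_units_mod_residue_class[OF qR pos(1) _ coprime_lift this, of 1]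
    show ?thesis by (simp add: u_def)
  qed
  also have "\<dots> = (\<Sum>h<R. if d dvd h then of_nat R else 0)"
    by (intro sum.cong refl) (simp add: inner diag mult.left_commute)
  also have "\<dots> = of_nat (card {h\<in>{..<R}. d dvd h}) * of_nat R"
    by (simp flip: sum.inter_filter)
  also have "{h\<in>{..<R}. d dvd h} = (\<lambda>s. d * s) ` {..<r}"
    using pos by (auto simp: R_def mult.commute)
  also have "card \<dots> = r" using pos by (subst card_image) (auto simp: inj_on_def)
  finally show ?thesis by (simp add: qR)
qed

text \<open>
  Raising \<open>\<delta>\<close> to the power \<open>r ^ 3\<close> does not change it modulo \<open>r\<close>, as \<open>r\<close> is odd, and it makes the
  square congruent to \<open>1\<close> modulo \<open>r ^ 4\<close>, hence modulo \<open>q\<close>.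
\<close>

lemma sqrt_one_lift:
  assumes "[\<delta>\<^sup>2 = 1] (mod int r)"
  obtains e where "e \<in> sqrts_one_mod q" "[e = \<delta>] (mod int r)"
proof -
  \<comment> \<open>The factors \<open>r\<close> and \<open>r\<^sup>2\<close> lift from the modulus \<open>r\<close> to \<open>r\<^sup>2\<close> and from there to \<open>r ^ 4\<close>.\<close>
  define N where "N = r * r\<^sup>2"
  define e where "e = \<delta> ^ N mod int q"
  have "[(\<delta>\<^sup>2) ^ r = 1] (mod int (r\<^sup>2))" using cong_1_power_modulus[OF assms] by simp
  from cong_1_power_modulus[OF this] have "[(\<delta>\<^sup>2) ^ N = 1] (mod (int r ^ 2) ^ 2)"
    by (simp add: N_def power_mult)
  moreover have "int q dvd (int r ^ 2) ^ 2"
    unfolding power_mult[symmetric] using dvd_trans[OF q_dvd le_imp_power_dvd[of 3 "2 * 2" "int r"]] by simp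
  ultimately have "[(\<delta>\<^sup>2) ^ N = 1] (mod int q)" by (rule cong_dvd_modulus)
  hence "[(\<delta> ^ N)\<^sup>2 = 1] (mod int q)" by (simp only: power_mult[symmetric] mult.commute)
  hence e1: "e \<in> sqrts_one_mod q" using pos by (simp add: sqrts_one_mod_def e_def cong_def power_mod)
  have "odd N" using odd_q by (auto simp: N_def q_eq)
  then obtain M where M: "N = 2 * M + 1" by (auto elim: oddE)
  have "[(\<delta>\<^sup>2) ^ M * \<delta> = 1 ^ M * \<delta>] (mod int r)" by (intro cong_scalar_right cong_pow assms)
  moreover have "\<delta> ^ N = (\<delta>\<^sup>2) ^ M * \<delta>"
    by (simp only: M power_add power_mult power_one_right)
  ultimately have "[\<delta> ^ N = \<delta>] (mod int r)" by simp
  moreover have "[e = \<delta> ^ N] (mod int r)"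
    by (rule cong_dvd_modulus[of _ _ "int q"]) (simp_all add: e_def q_eq)
  ultimately have "[e = \<delta>] (mod int r)" using cong_trans by blast
  thus thesis using that e1 by blast
qed

text \<open>
  Modulo \<open>r\<close>, the sum \<open>e + e'\<close> is \<open>2 * e\<close>, so it is a unit, and \<open>q\<close> divides
  \<open>(e + e') * (e - e')\<close>.
\<close>

lemma sqrts_one_cong_imp_eq:
  assumes "e \<in> sqrts_one_mod q" "e' \<in> sqrts_one_mod q" "[e = e'] (mod int r)"
  shows "e = e'"
proof -
  have sq: "[e\<^sup>2 = 1] (mod int q)" "[e'\<^sup>2 = 1] (mod int q)"
    using assms(1,2) by (simp_all only: sqrts_one_mod_def mem_Collect_eq)
  have "[2 * e = e + e'] (mod int r)" using cong_add[OF cong_refl assms(3), of e] by simp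
  moreover have "coprime (2 * e) (int r)"
    by (rule coprime_lower) (use coprime_if_square_cong_1[OF sq(1)] coprime_2_q in simp)
  ultimately have cop: "coprime (e + e') (int q)"
    using coprime_lift coprime_cong_transfer_left by blast
  have "[e\<^sup>2 = e'\<^sup>2] (mod int q)" using sq cong_sym cong_trans by blast
  moreover have "e\<^sup>2 - e'\<^sup>2 = (e + e') * (e - e')" by (simp add: power2_eq_square algebra_simps)
  ultimately have "int q dvd (e + e') * (e - e')" by (simp only: cong_iff_dvd_diff)
  moreover have "coprime (int q) (e + e')" using cop by (simp only: coprime_commute)
  ultimately have "int q dvd e - e'" by (simp only: coprime_dvd_mult_right_iff)
  hence "[e = e'] (mod int q)" by (simp only: cong_iff_dvd_diff)
  moreover have "0 \<le> e" "e < int q" "0 \<le> e'" "e' < int q"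
    using assms(1,2) by (simp_all only: sqrts_one_mod_def mem_Collect_eq atLeastLessThan_iff)
  ultimately show ?thesis by (intro cong_less_imp_eq_int)
qed

lemma gauss_term_mult_sqrt_one:
  assumes "e \<in> sqrts_one_mod q"
  shows "F (e * a) = \<chi> e * F a"
proof -
  have "[n * (e * a)\<^sup>2 = n * (1 * a\<^sup>2)] (mod int q)"
    unfolding power_mult_distrib using assms
    by (intro cong_scalar_left cong_scalar_right) (simp add: sqrts_one_mod_def)
  thus ?thesis using unity_char_cong[OF pos(1)]
    by (simp add: gauss_term_def dirichlet_character_mult[OF char])
qed

lemma coprime_sqrt_one: "e \<in> sqrts_one_mod q \<Longrightarrow> coprime e (int q)"
  by (rule coprime_if_square_cong_1) (simp add: sqrts_one_mod_def)

text \<open>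
  If \<open>a\<close> and \<open>y\<close> are both stationary, then \<open>a\<^sup>2 \<equiv> y\<^sup>2\<close> modulo \<open>r\<close>, so \<open>a / y\<close> is a square root of one
  modulo \<open>r\<close> and lifts to one modulo \<open>q\<close>.
\<close>

lemma stationary_points_partition:
  assumes y: "coprime y (int q)" "z y = 1"
  shows "{a. a \<in> units_mod q \<and> z a = 1} =
    (\<Union>e\<in>sqrts_one_mod q. {a. a \<in> units_mod q \<and> [a = e * y] (mod int r)})"
proof (intro equalityI subsetI)
  fix a assume "a \<in> {a. a \<in> units_mod q \<and> z a = 1}"
  hence a: "a \<in> units_mod q" "z a = z y" using y by auto
  obtain y' where y': "[y * y' = 1] (mod int r)"
    using cong_solve_coprime_int coprime_lower(1)[OF y(1)] by blast
  have "[(a * y')\<^sup>2 = y\<^sup>2 * y'\<^sup>2] (mod int r)"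
    unfolding power_mult_distrib using z_eq_imp_cong[OF a(2)] by (rule cong_scalar_right)
  also have "[y\<^sup>2 * y'\<^sup>2 = 1] (mod int r)"
    using cong_pow[OF y', of 2] by (simp add: power_mult_distrib)
  finally obtain e where e: "e \<in> sqrts_one_mod q" "[e = a * y'] (mod int r)"
    by (rule sqrt_one_lift)
  have "[e * y = a * y' * y] (mod int r)" using e(2) by (rule cong_scalar_right)
  also have "[a * y' * y = a * 1] (mod int r)"
    using cong_scalar_left[OF y', of a] by (simp add: mult_ac)
  finally have "[a = e * y] (mod int r)" by (simp add: cong_sym)
  thus "a \<in> (\<Union>e\<in>sqrts_one_mod q. {a. a \<in> units_mod q \<and> [a = e * y] (mod int r)})"
    using e(1) a(1) by blast
next
  fix a assume "a \<in> (\<Union>e\<in>sqrts_one_mod q. {a. a \<in> units_mod q \<and> [a = e * y] (mod int r)})"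
  then obtain e where e: "e \<in> sqrts_one_mod q" "a \<in> units_mod q" "[a = e * y] (mod int r)" by blast
  have "[e\<^sup>2 = 1] (mod int r)"
    by (rule cong_dvd_modulus[of _ _ "int q"]) (use e(1) in \<open>simp_all add: sqrts_one_mod_def q_eq\<close>)
  from cong_trans[OF cong_pow[OF e(3), of 2, unfolded power_mult_distrib] cong_scalar_right[OF this]]
  have "[a\<^sup>2 = 1 * y\<^sup>2] (mod int r)" .
  hence "z a = z y" using z_cong by simp
  thus "a \<in> {a. a \<in> units_mod q \<and> z a = 1}" using y e by simp
qed

text \<open>
  A nonzero \<open>G\<close> forces \<open>\<chi>\<close> to be trivial on the square roots of one, and it forces a stationary
  point to exist. Then \<open>G\<close> is the sum of \<open>2 ^ \<omega>(q)\<close> equal contributions of squared modulus \<open>q\<close>.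
\<close>

theorem norm_square_dichotomy:
  defines "G \<equiv> (\<Sum>a\<in>units_mod q. F a)"
  shows "(cmod G)\<^sup>2 = 0 \<or> (cmod G)\<^sup>2 = 4 ^ num_prime_divisors q * real q"
proof (cases "G = 0")
  case False
  let ?E = "sqrts_one_mod q"
  have triv: "\<chi> e = 1" if e: "e \<in> ?E" for e
  proof -
    have "G = (\<Sum>a\<in>units_mod q. F (e * a))"
      unfolding G_def using sum_units_mod_mult[OF pos(1) coprime_sqrt_one[OF e]] gauss_term_cong[OF char pos(1)]
      by simp
    also have "\<dots> = \<chi> e * G" by (simp add: G_def gauss_term_mult_sqrt_one[OF e] sum_distrib_left)
    finally show ?thesis using False by simp
  qed
  have "{a. a \<in> units_mod q \<and> z a = 1} \<noteq> {}"
    using False unfolding G_def sum_gauss_term_stationary by (metis sum.empty)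
  then obtain y where "y \<in> units_mod q" "z y = 1" by blast
  hence y: "coprime y (int q)" "z y = 1" by (auto dest: units_modD)
  define T where "T e = (\<Sum>a | a \<in> units_mod q \<and> [a = e * y] (mod int r). F a)" for e
  have T: "T e = T 1" if e: "e \<in> ?E" for e
  proof -
    have "T e = (\<Sum>a\<in>units_mod q. if [a = e * y] (mod int r) then F a else 0)"
      by (simp add: T_def sum.inter_filter)
    also have "\<dots> = (\<Sum>a\<in>units_mod q. if [e * a = e * y] (mod int r) then F (e * a) else 0)"
    proof (rule sum_units_mod_mult[OF pos(1) coprime_sqrt_one[OF e], symmetric])
      fix a a' assume aa: "[a = a'] (mod int q)"
      hence "[a = a'] (mod int r)" by (intro cong_dvd_modulus[OF aa]) (simp add: q_eq)
      thus "(if [a = e * y] (mod int r) then F a else 0) = (if [a' = e * y] (mod int r) then F a' else 0)"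
        using gauss_term_cong[OF char pos(1) aa] by (auto simp: cong_def)
    qed
    also have "\<dots> = (\<Sum>a\<in>units_mod q. if [a = 1 * y] (mod int r) then F a else 0)"
      using cong_mult_lcancel[OF coprime_lower(1)[OF coprime_sqrt_one[OF e]]]
      by (intro sum.cong refl if_cong) (simp_all add: gauss_term_mult_sqrt_one[OF e] triv[OF e])
    also have "\<dots> = T 1" by (simp add: T_def sum.inter_filter)
    finally show ?thesis .
  qed
  have "G = (\<Sum>e\<in>?E. T e)"
    unfolding G_def sum_gauss_term_stationary stationary_points_partition[OF y] T_def
  proof (rule sum.UNION_disjoint)
    show "\<forall>e\<in>?E. \<forall>e'\<in>?E. e \<noteq> e' \<longrightarrow>
      {a. a \<in> units_mod q \<and> [a = e * y] (mod int r)} \<inter> {a. a \<in> units_mod q \<and> [a = e' * y] (mod int r)} = {}"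
    proof (intro ballI impI, rule ccontr)
      fix e e' assume ee: "e \<in> ?E" "e' \<in> ?E" "e \<noteq> e'"
        and "{a. a \<in> units_mod q \<and> [a = e * y] (mod int r)} \<inter> {a. a \<in> units_mod q \<and> [a = e' * y] (mod int r)} \<noteq> {}"
      then obtain a where "[a = e * y] (mod int r)" "[a = e' * y] (mod int r)" by blast
      hence "[e * y = e' * y] (mod int r)" using cong_sym cong_trans by blast
      hence "[e = e'] (mod int r)" using cong_mult_rcancel[OF coprime_lower(1)[OF y(1)]] by blast
      thus False using sqrts_one_cong_imp_eq ee by blast
    qed
  qed simp_all
  also have "\<dots> = of_nat (card ?E) * T 1" by (simp add: T)
  also have "card ?E = 2 ^ num_prime_divisors q" by (rule card_sqrts_one_mod[OF odd_q])
  finally have G: "G = 2 ^ num_prime_divisors q * T 1" by simp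
  have "complex_of_real ((cmod (T 1))\<^sup>2) = of_nat q"
    using norm_square_stationary_class[OF y] by (simp add: T_def complex_norm_square del: of_real_power)
  hence "complex_of_real ((cmod (T 1))\<^sup>2) = complex_of_real (real q)" by simp
  hence "(cmod (T 1))\<^sup>2 = real q" using of_real_eq_iff by blast
  moreover have "cmod G = 2 ^ num_prime_divisors q * cmod (T 1)"
    by (simp add: G norm_mult norm_power)
  moreover have "((2::real) ^ num_prime_divisors q)\<^sup>2 = (2\<^sup>2) ^ num_prime_divisors q"
    by (simp only: power_mult[symmetric] mult.commute)
  ultimately show ?thesis by (simp add: power_mult_distrib)
qed simp

end

section \<open>The even moments\<close>

theorem theorem1:
  fixes q m :: nat and n :: int
  assumes "q > 1" and "odd q" and "square_full q"
    and "m \<ge> 2"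
    and "coprime n (int q)"
  shows "(\<Sum>\<chi> | dirichlet_character q \<chi>. cmod (quad_gauss_sum n \<chi> q) ^ (2 * m)) =
         4 ^ ((m - 1) * num_prime_divisors q) * real q ^ (m - 1) * (real (totient q))\<^sup>2"
proof -
  define c where "c = 4 ^ num_prime_divisors q * real q"
  obtain r d where rd: "q = r\<^sup>2 * d" "d dvd r" using square_full_decomposition[OF assms(3)] .
  have "cmod (quad_gauss_sum n \<chi> q) ^ (2 * m) = c ^ (m - 1) * (cmod (quad_gauss_sum n \<chi> q))\<^sup>2"
    if chi: "dirichlet_character q \<chi>" for \<chi>
  proof -
    interpret square_full_gauss q r d n \<chi> using rd assms chi by unfold_locales
    let ?x = "(cmod (quad_gauss_sum n \<chi> q))\<^sup>2"
    have "?x = 0 \<or> ?x = c"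
      using norm_square_dichotomy unfolding c_def quad_gauss_sum_eq[OF chi assms(1)] .
    moreover have "?x ^ m = ?x ^ (m - 1) * ?x"
      using assms(4) power_minus_mult[of m ?x] by simp
    ultimately have "?x ^ m = c ^ (m - 1) * ?x" by auto
    thus ?thesis by (simp only: power_mult)
  qed
  hence "(\<Sum>\<chi> | dirichlet_character q \<chi>. cmod (quad_gauss_sum n \<chi> q) ^ (2 * m)) =
      c ^ (m - 1) * (\<Sum>\<chi> | dirichlet_character q \<chi>. (cmod (quad_gauss_sum n \<chi> q))\<^sup>2)"
    by (simp add: sum_distrib_left)
  also have "\<dots> = c ^ (m - 1) * (real (totient q))\<^sup>2"
    by (simp add: second_moment_quad_gauss_sum[OF assms(2,1)])
  also have "c ^ (m - 1) = 4 ^ ((m - 1) * num_prime_divisors q) * real q ^ (m - 1)"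
    unfolding c_def power_mult_distrib power_mult[symmetric] by (simp only: mult.commute)
  finally show ?thesis by simp
qed

end
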